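(* Let $d \ge 3$ and $f \in \mathcal{R}_d$. Then $M_f$ is a $K$-algebra (that is, $M_f$ is a $K$-subspace of $\mathrm{Mat}_K(r,r)$ containing the identity matrix and closed under matrix multiplication), and all commutators $AB-BA$ with $A,B \in M_f$ belong to $\ker \gamma_f$. In particular, $M_f$ is commutative if $\mathrm{ann}_R(f)_1 = 0$.
   Context: $K$ is a field, $r\ge 1$, $R=K[\partial_1,\dots,\partial_r]$ is a polynomial ring with the standard grading, and $\mathcal{R}=K[x_1,\dots,x_r]^{DP}=\bigoplus_{d\ge0}\mathcal{R}_d$ is the divided power ring: $\mathcal{R}_d$ has $K$-basis $x^{(\alpha)}=\prod_i x_i^{(\alpha_i)}$, $\alpha\in\mathbb{N}_0^r$, $|\alpha|=d$, with multiplication generated by $x_i^{(a)}x_i^{(b)}=\binom{a+b}{a}x_i^{(a+b)}$. $R$ acts on $\mathcal{R}$ by $\partial^\beta(x^{(\alpha)})=x^{(\alpha-\beta)}$ (zero if some $\alpha_i<\beta_i$). For $f\in\mathcal{R}_d$, $\mathrm{ann}_R(f)=\{D\in R : Df=0\}$, a homogeneous ideal with degree $e$ part $\mathrm{ann}_R(f)_e$. Put $\partial=[\partial_1,\dots,\partial_r]^T$; matrices with entries in $R$ act entrywise, so $\partial f=[\partial_1f,\dots,\partial_rf]^T$. For $A\in\mathrm{Mat}_K(r,r)$, $I_2(\partial\; A\partial)\subseteq R$ is the ideal generated by the $2\times2$ minors of the $r\times 2$ matrix with columns $\partial$ and $A\partial$. Define $$M_f=\{A\in\mathrm{Mat}_K(r,r)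 : I_2(\partial\; A\partial)\subseteq \mathrm{ann}_R(f)\}.$$ For $d>0$ and $A\in M_f$ there is a unique $g\in\mathcal{R}_d$ with $\partial g=A\,\partial f$; the $K$-linear map $\gamma_f:M_f\to\mathcal{R}_d$ sends $A$ to this $g$. *)

theory Defs
  imports "HOL-Analysis.Determinants" "HOL-Library.Poly_Mapping"
begin

(* The index set {1,...,r} is the finite (hence nonempty) type 'r; an exponent alpha in N_0^r
   is an element of 'r \<Rightarrow>\<^sub>0 nat. *)
type_synonym ('r, 'k) poly_ring = "('r \<Rightarrow>\<^sub>0 nat) \<Rightarrow>\<^sub>0 'k"

(* An element is stored by its coefficients with respect to the basis of divided monomials
   x^(alpha).  Only the graded vector space and the action of the polynomial ring are used
   below; the product "*" that the type inherits from Poly_Mapping is the ordinary polynomial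
   product, not the multiplication of divided powers. *)
type_synonym ('r, 'k) divpow = "('r \<Rightarrow>\<^sub>0 nat) \<Rightarrow>\<^sub>0 'k"

definition homogeneous_part :: "nat \<Rightarrow> (('r::finite \<Rightarrow>\<^sub>0 nat) \<Rightarrow>\<^sub>0 'k::zero) set" where
  "homogeneous_part d =
    {p. \<forall>\<alpha>\<in>Poly_Mapping.keys p. (\<Sum>i\<in>UNIV. Poly_Mapping.lookup \<alpha> i) = d}"

(* Bilinear extension of the contraction action on monomials, see contract_monom.  The
   componentwise order is spelled out because the instance of "\<le>" for poly_mapping is
   lexicographic. *)
definition contract :: "('r::finite, 'k::field) poly_ring \<Rightarrow> ('r, 'k) divpow \<Rightarrow> ('r, 'k) divpow" where
  "contract D f =
    (\<Sum>\<beta>\<in>Poly_Mapping.keys D. \<Sum>\<alpha>\<in>Poly_Mapping.keys f.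
      if \<forall>i. Poly_Mapping.lookup \<beta> i \<le> Poly_Mapping.lookup \<alpha> i
      then Poly_Mapping.single (\<alpha> - \<beta>) (Poly_Mapping.lookup D \<beta> * Poly_Mapping.lookup f \<alpha>)
      else 0)"

lemma contract_monom:
  "contract (Poly_Mapping.single \<beta> (1::'k::field)) (Poly_Mapping.single \<alpha> 1) =
    (if \<forall>i. Poly_Mapping.lookup \<beta> i \<le> Poly_Mapping.lookup \<alpha> i
     then Poly_Mapping.single (\<alpha> - \<beta>) 1 else 0)"
proof -
  have "Poly_Mapping.keys (Poly_Mapping.single \<gamma> (1::'k)) = {\<gamma>}" for \<gamma> :: "'a \<Rightarrow>\<^sub>0 nat"
    by simp
  then show ?thesis
    unfolding contract_def by (simp only: sum.insert sum.empty finite.emptyI) simp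
qed

definition ann :: "('r::finite, 'k::field) divpow \<Rightarrow> ('r, 'k) poly_ring set" where
  "ann f = {D. contract D f = 0}"

definition ann_deg :: "('r::finite, 'k::field) divpow \<Rightarrow> nat \<Rightarrow> ('r, 'k) poly_ring set" where
  "ann_deg f e = ann f \<inter> homogeneous_part e"

definition partials :: "('r::finite, 'k::field) poly_ring ^ 'r" where
  "partials = (\<chi> i. Poly_Mapping.single (Poly_Mapping.single i 1) 1)"

definition const_mat :: "'k::field ^ 'r ^ 'r \<Rightarrow> ('r::finite, 'k) poly_ring ^ 'r ^ 'r" where
  "const_mat A = (\<chi> i j. Poly_Mapping.single 0 (A $ i $ j))"

definition contract_vec ::
  "('r::finite, 'k::field) poly_ring ^ 'n \<Rightarrow> ('r, 'k) divpow \<Rightarrow> ('r, 'k) divpow ^ 'n" where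
  "contract_vec v f = (\<chi> i. contract (v $ i) f)"

definition minors2 :: "'a::comm_ring_1 ^ 'n ^ 'm \<Rightarrow> 'a set" where
  "minors2 M = {det (\<chi> k l. M $ s k $ t l) | (s :: 2 \<Rightarrow> 'm) (t :: 2 \<Rightarrow> 'n). inj s \<and> inj t}"

(* The ideal generated by a set is its span in the ring regarded as a module over itself. *)
definition I2 :: "'a::comm_ring_1 ^ 'n ^ 'm \<Rightarrow> 'a set" where
  "I2 M = module.span (*) (minors2 M)"

definition two_columns :: "'a ^ 'm \<Rightarrow> 'a ^ 'm \<Rightarrow> 'a ^ 2 ^ 'm" where
  "two_columns u v = (\<chi> i k. if k = 1 then u $ i else v $ i)"

definition Mat_alg :: "('r::finite, 'k::field) divpow \<Rightarrow> ('k ^ 'r ^ 'r) set" where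
  "Mat_alg f = {A. I2 (two_columns partials (const_mat A *v partials)) \<subseteq> ann f}"

(* A (partials f) is written (A partials) f.  The degree d is an argument because the zero
   element is homogeneous of every degree.  For d > 0, f homogeneous of degree d and A in
   Mat_alg f, exactly one g satisfies the condition. *)
definition gamma ::
  "nat \<Rightarrow> ('r::finite, 'k::field) divpow \<Rightarrow> 'k ^ 'r ^ 'r \<Rightarrow> ('r, 'k) divpow" where
  "gamma d f A = (THE g. g \<in> homogeneous_part d \<and>
     contract_vec partials g = contract_vec (const_mat A *v partials) f)"

definition ker_gamma :: "nat \<Rightarrow> ('r::finite, 'k::field) divpow \<Rightarrow> ('k ^ 'r ^ 'r) set" where
  "ker_gamma d f = {A \<in> Mat_alg f. gamma d f A = 0}"

definition matrix_scale :: "'k::field \<Rightarrow> 'k ^ 'n ^ 'm \<Rightarrow> 'k ^ 'n ^ 'm" where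
  "matrix_scale c A = (\<chi> i j. c * A $ i $ j)"

definition matrix_subalgebra :: "('k::field ^ 'n ^ 'n) set \<Rightarrow> bool" where
  "matrix_subalgebra S \<longleftrightarrow>
    module.subspace matrix_scale S \<and> mat 1 \<in> S \<and> (\<forall>A\<in>S. \<forall>B\<in>S. A ** B \<in> S)"

end

theory Submission
  imports Defs
begin

text \<open>
  Let \<open>H\<close> be the Hessian of \<open>f\<close>, the symmetric matrix with entries \<open>\<partial>\<^sub>i \<partial>\<^sub>j f\<close>. Applied to \<open>f\<close>, the
  \<open>2 \<times> 2\<close> minors of the matrix with columns \<open>\<partial>\<close> and \<open>A \<partial>\<close> are the differences of opposite
  off-diagonal entries of \<open>A H\<close>. Hence \<open>A\<close> belongs to \<open>M\<^sub>f\<close> iff \<open>A H\<close> is symmetric. Contraction by a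
  monomial merely shifts coefficients (\<open>lookup_contract\<close>), so everything can be read off
  coefficientwise: the coefficient matrix \<open>H(\<gamma>)\<close> of \<open>H\<close> at the exponent \<open>\<gamma>\<close> has entries
  \<open>f(\<gamma> + e\<^sub>i + e\<^sub>j)\<close> (\<open>hessian_coeff\<close>), and \<open>A \<in> M\<^sub>f\<close> iff \<open>A H(\<gamma>)\<close> is symmetric for all \<open>\<gamma>\<close>
  (\<open>Mat_alg_iff\<close>). This is linear in \<open>A\<close> and holds for the identity matrix.

  For \<open>A, B \<in> M\<^sub>f\<close> the transpose of \<open>A B H\<close> is \<open>B A H\<close>, so closure under products amounts to
  \<open>(A B - B A) H = 0\<close>. Here the third derivatives help. The matrices \<open>H(\<gamma> + e\<^sub>k)\<close>, for varying \<open>k\<close>,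
  are the slices of a totally symmetric tensor \<open>T\<close>, and membership in \<open>M\<^sub>f\<close> says that a matrix may be
  moved from one of the three slots of \<open>T\<close> to any other. Three slots are enough to move \<open>A\<close> and \<open>B\<close>
  past each other, which gives \<open>A B T = B A T\<close> (\<open>commute_on_symmetric_slices\<close>).

  The rest is the principle that a homogeneous element of positive degree is zero once all its first
  partials are: each exponent of positive degree has the form \<open>\<gamma> + e\<^sub>k\<close>. Since \<open>d \<ge> 3\<close>, the entries of
  \<open>H\<close> have degree at least 1, and \<open>(A B - B A) T = 0\<close> descends to \<open>(A B - B A) H = 0\<close>
  (\<open>commutator_annihilates_hessian\<close>). The same descent yields \<open>(A B - B A) \<partial> f = 0\<close>
  (\<open>hessian_kernel_annihilates\<close>), and then the image of \<open>A B - B A\<close> under \<open>\<gamma>\<^sub>f\<close> has vanishing partials,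
  hence is zero. Finally, the entries of \<open>(A B - B A) \<partial>\<close> are linear forms annihilating \<open>f\<close>; if no
  nonzero linear form does so, then \<open>A B = B A\<close>.
\<close>

section \<open>The contraction action\<close>

text \<open>The divided power basis makes contraction a shift of coefficients: no binomial coefficients
  appear, and the argument is uniform in the characteristic of the field.\<close>

lemma lookup_contract:
  fixes D :: "('r::finite, 'k::field) poly_ring"
  shows "Poly_Mapping.lookup (contract D f) \<gamma> =
    (\<Sum>\<beta>\<in>Poly_Mapping.keys D. Poly_Mapping.lookup D \<beta> * Poly_Mapping.lookup f (\<gamma> + \<beta>))"
proof -
  \<comment> \<open>The test for divisibility becomes a sum over all \<open>\<delta>\<close> with \<open>\<delta> + \<beta> = \<alpha>\<close>; this removes the
     truncated subtraction of exponents.\<close>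
  have *: "(if \<forall>i. Poly_Mapping.lookup \<beta> i \<le> Poly_Mapping.lookup \<alpha> i
      then Poly_Mapping.single (\<alpha> - \<beta>) c else 0) = 
      (\<Sum>\<delta>\<in>{\<delta>. \<delta> + \<beta> = \<alpha>}. Poly_Mapping.single \<delta> c)"
    for \<alpha> \<beta> :: "'r \<Rightarrow>\<^sub>0 nat" and c :: 'k
  proof (cases "\<forall>i. Poly_Mapping.lookup \<beta> i \<le> Poly_Mapping.lookup \<alpha> i")
    case True
    then have "\<alpha> - \<beta> + \<beta> = \<alpha>"
      by (intro poly_mapping_eqI) (simp add: lookup_add lookup_minus)
    then have "{\<delta>. \<delta> + \<beta> = \<alpha>} = {\<alpha> - \<beta>}"
      by auto
    with True show ?thesis by simp
  next
    case False
    then have "{\<delta>. \<delta> + \<beta> = \<alpha>} = {}"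
      by (auto simp: lookup_add)
    with False show ?thesis by (simp only: if_False sum.empty)
  qed
  have fin: "finite {\<delta>. \<delta> + \<beta> = \<alpha>}" for \<alpha> \<beta> :: "'r \<Rightarrow>\<^sub>0 nat"
    by (rule finite_subset[of _ "{\<alpha> - \<beta>}"]) auto
  have "Poly_Mapping.lookup (contract D f) \<gamma> = (\<Sum>\<beta>\<in>Poly_Mapping.keys D. \<Sum>\<alpha>\<in>Poly_Mapping.keys f.
      if \<alpha> = \<gamma> + \<beta> then Poly_Mapping.lookup D \<beta> * Poly_Mapping.lookup f \<alpha> else 0)"
    unfolding contract_def * lookup_sum lookup_single when_def
    by (intro sum.cong refl) (auto simp: sum.delta' fin)
  also have "\<dots> = (\<Sum>\<beta>\<in>Poly_Mapping.keys D. Poly_Mapping.lookup D \<beta> * Poly_Mapping.lookup f (\<gamma> + \<beta>))"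
    by (intro sum.cong refl) (simp add: sum.delta in_keys_iff)
  finally show ?thesis .
qed

lemma lookup_contract_superset:
  fixes D :: "('r::finite, 'k::field) poly_ring"
  assumes "finite S" "Poly_Mapping.keys D \<subseteq> S"
  shows "Poly_Mapping.lookup (contract D f) \<gamma> =
    (\<Sum>\<beta>\<in>S. Poly_Mapping.lookup D \<beta> * Poly_Mapping.lookup f (\<gamma> + \<beta>))"
  unfolding lookup_contract
  by (rule sum.mono_neutral_left) (use assms in \<open>auto simp: in_keys_iff\<close>)

lemma lookup_contract_single:
  fixes f :: "('r::finite, 'k::field) divpow"
  shows "Poly_Mapping.lookup (contract (Poly_Mapping.single \<beta> c) f) \<gamma> =
    c * Poly_Mapping.lookup f (\<gamma> + \<beta>)"
  by (subst lookup_contract_superset[of "{\<beta>}"]) auto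

lemma contract_zero_left [simp]: "contract 0 f = 0"
  by (simp add: contract_def)

lemma contract_zero_right [simp]: "contract D 0 = 0"
  by (simp add: contract_def)

lemma contract_add_left:
  fixes f :: "('r::finite, 'k::field) divpow"
  shows "contract (D + E) f = contract D f + contract E f"
proof (rule poly_mapping_eqI)
  fix \<gamma>
  define S where "S = Poly_Mapping.keys D \<union> Poly_Mapping.keys E"
  have "finite S" "Poly_Mapping.keys D \<subseteq> S" "Poly_Mapping.keys E \<subseteq> S" "Poly_Mapping.keys (D + E) \<subseteq> S"
    using keys_add[of D E] by (auto simp: S_def)
  then show "Poly_Mapping.lookup (contract (D + E) f) \<gamma> =
      Poly_Mapping.lookup (contract D f + contract E f) \<gamma>"
    by (simp add: lookup_contract_superset[of S] lookup_add distrib_right sum.distrib)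
qed

lemma contract_add_right: "contract D (f + g) = contract D f + contract D g"
  by (rule poly_mapping_eqI) (simp add: lookup_contract lookup_add distrib_left sum.distrib)

lemma contract_diff_left:
  fixes f :: "('r::finite, 'k::field) divpow"
  shows "contract (D - E) f = contract D f - contract E f"
  using contract_add_left[of "D - E" E f] by (simp add: eq_diff_eq)

lemma contract_sum_left:
  "contract (\<Sum>i\<in>I. D i) f = (\<Sum>i\<in>I. contract (D i) f)"
  by (induction I rule: infinite_finite_induct) (simp_all add: contract_add_left)

lemma poly_mapping_single_add_induct [case_names zero single_add]:
  assumes "P 0" and "\<And>a b p. P p \<Longrightarrow> P (Poly_Mapping.single a b + p)"
  shows "P (p :: 'a \<Rightarrow>\<^sub>0 'b::comm_monoid_add)"
proof (induction p rule: update_induct)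
  case (update p a b)
  have "Poly_Mapping.update a b p = Poly_Mapping.single a b + p"
    using update(1) by (intro poly_mapping_eqI)
      (auto simp: lookup_update lookup_add lookup_single in_keys_iff when_def)
  with update assms(2) show ?case by simp
qed (rule assms(1))

lemma contract_mult: "contract (D * E) f = contract D (contract E f)"
proof (induction D rule: poly_mapping_single_add_induct)
  case (single_add \<beta> c D)
  have "contract (Poly_Mapping.single \<beta> c * E) f = contract (Poly_Mapping.single \<beta> c) (contract E f)"
  proof (induction E rule: poly_mapping_single_add_induct)
    case (single_add \<beta>' c' E)
    have "contract (Poly_Mapping.single \<beta> c * Poly_Mapping.single \<beta>' c') f =
        contract (Poly_Mapping.single \<beta> c) (contract (Poly_Mapping.single \<beta>' c') f)"
      by (rule poly_mapping_eqI) (simp add: mult_single lookup_contract_single ac_simps)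
    with single_add show ?case
      by (simp add: distrib_left contract_add_left contract_add_right)
  qed simp
  with single_add show ?case
    by (simp add: distrib_right contract_add_left)
qed simp

lemma ideal_module: "module ((*) :: 'a::comm_ring_1 \<Rightarrow> 'a \<Rightarrow> 'a)"
  by unfold_locales (auto simp: algebra_simps)

text \<open>Since contraction is a module action, \<open>ann f\<close> is an ideal, and it suffices to test the
  generators of \<open>I2 M\<close>.\<close>

lemma I2_subset_ann_iff:
  fixes f :: "('r::finite, 'k::field) divpow"
  shows "I2 M \<subseteq> ann f \<longleftrightarrow> minors2 M \<subseteq> ann f"
proof -
  interpret ideal: module "(*) :: ('r, 'k) poly_ring \<Rightarrow> _" by (rule ideal_module)
  have "ideal.subspace (ann f)"
    by (auto simp: ideal.subspace_def ann_def contract_add_left contract_mult)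
  then show ?thesis
    unfolding I2_def using ideal.span_minimal ideal.span_superset by blast
qed

section \<open>The matrices that symmetrize the Hessian\<close>

text \<open>A selection of both columns may also list them in reverse order. That only changes the sign of
  the minor, and so does exchanging the two rows.\<close>

lemma minors2_two_columns:
  fixes u v :: "'a::comm_ring_1 ^ 'm"
  shows "minors2 (two_columns u v) =
    {u $ i * v $ j - u $ j * v $ i | i j. i \<noteq> j}"
proof (intro equalityI subsetI)
  fix x assume "x \<in> minors2 (two_columns u v)"
  then obtain s :: "2 \<Rightarrow> 'm" and t :: "2 \<Rightarrow> 2"
    where x: "x = det (\<chi> k l. two_columns u v $ s k $ t l)" and s: "inj s" and t: "inj t"
    by (auto simp: minors2_def)
  have "s 1 \<noteq> s 2" "t 1 \<noteq> t 2"
    using s t by (auto simp: inj_eq)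
  moreover have "t 1 = 1 \<and> t 2 = 2 \<or> t 1 = 2 \<and> t 2 = 1"
    using \<open>t 1 \<noteq> t 2\<close> exhaust_2[of "t 1"] exhaust_2[of "t 2"] by auto
  ultimately have "x = u $ s 1 * v $ s 2 - u $ s 2 * v $ s 1 \<or> x = u $ s 2 * v $ s 1 - u $ s 1 * v $ s 2"
    by (auto simp: x det_2 two_columns_def algebra_simps)
  with \<open>s 1 \<noteq> s 2\<close> show "x \<in> {u $ i * v $ j - u $ j * v $ i | i j. i \<noteq> j}"
    unfolding mem_Collect_eq by metis
next
  fix x assume "x \<in> {u $ i * v $ j - u $ j * v $ i | i j. i \<noteq> j}"
  then obtain i j where x: "x = u $ i * v $ j - u $ j * v $ i" and "i \<noteq> j"
    by blast
  define s :: "2 \<Rightarrow> 'm" where "s = (\<lambda>k. if k = 1 then i else j)"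
  have "inj s"
    using \<open>i \<noteq> j\<close> by (auto simp: inj_def s_def) (metis exhaust_2)+
  moreover have "x = det (\<chi> k l. two_columns u v $ s k $ id l)"
    by (simp add: x det_2 two_columns_def s_def algebra_simps)
  ultimately show "x \<in> minors2 (two_columns u v)"
    unfolding minors2_def mem_Collect_eq by (intro exI[of _ s] exI[of _ id]) simp
qed

abbreviation unit_exp :: "'r \<Rightarrow> 'r \<Rightarrow>\<^sub>0 nat" where
  "unit_exp i \<equiv> Poly_Mapping.single i (Suc 0)"

text \<open>The matrix of coefficients of the second partials \<open>\<partial>\<^sub>i \<partial>\<^sub>j f\<close> at the exponent \<open>\<gamma>\<close>.\<close>

definition hessian_coeff :: "('r::finite, 'k::field) divpow \<Rightarrow> ('r \<Rightarrow>\<^sub>0 nat) \<Rightarrow> 'k ^ 'r ^ 'r" where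
  "hessian_coeff f \<gamma> = (\<chi> i j. Poly_Mapping.lookup f (\<gamma> + unit_exp i + unit_exp j))"

lemma transpose_hessian_coeff [simp]: "transpose (hessian_coeff f \<gamma>) = hessian_coeff f \<gamma>"
  by (simp add: transpose_def hessian_coeff_def vec_eq_iff ac_simps)

lemma const_mat_partials:
  fixes A :: "'k::field ^ 'r ^ 'r::finite"
  shows "(const_mat A *v partials) $ i = (\<Sum>k\<in>UNIV. Poly_Mapping.single (unit_exp k) (A $ i $ k))"
  by (simp add: matrix_vector_mult_def const_mat_def partials_def mult_single)

lemma lookup_contract_const_mat_partials:
  fixes f :: "('r::finite, 'k::field) divpow"
  shows "Poly_Mapping.lookup (contract ((const_mat A *v partials) $ i) f) \<gamma> =
    (\<Sum>k\<in>UNIV. A $ i $ k * Poly_Mapping.lookup f (\<gamma> + unit_exp k))"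
  by (simp add: const_mat_partials contract_sum_left lookup_sum lookup_contract_single)

lemma lookup_contract_partials:
  fixes f :: "('r::finite, 'k::field) divpow"
  shows "Poly_Mapping.lookup (contract (partials $ i) f) \<gamma> = Poly_Mapping.lookup f (\<gamma> + unit_exp i)"
  by (simp add: partials_def lookup_contract_single)

lemma lookup_contract_const_mat_partials_shift:
  fixes f :: "('r::finite, 'k::field) divpow"
  shows "Poly_Mapping.lookup (contract ((const_mat A *v partials) $ i) f) (\<gamma> + unit_exp j) =
    (A ** hessian_coeff f \<gamma>) $ i $ j"
  unfolding lookup_contract_const_mat_partials
  by (simp add: hessian_coeff_def matrix_matrix_mult_def ac_simps)

text \<open>The minor from rows \<open>i\<close> and \<open>j\<close> acts on \<open>f\<close> as \<open>\<partial>\<^sub>i (A \<partial>)\<^sub>j - \<partial>\<^sub>j (A \<partial>)\<^sub>i\<close>, which compares the entries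
  of \<open>A H\<close> at \<open>(j, i)\<close> and \<open>(i, j)\<close>.\<close>

lemma Mat_alg_iff:
  fixes f :: "('r::finite, 'k::field) divpow"
  shows "A \<in> Mat_alg f \<longleftrightarrow>
    (\<forall>\<gamma>. transpose (A ** hessian_coeff f \<gamma>) = A ** hessian_coeff f \<gamma>)"
proof -
  let ?l = "const_mat A *v partials :: ('r, 'k) poly_ring ^ 'r"
  have minor: "Poly_Mapping.lookup (contract (partials $ i * ?l $ j - partials $ j * ?l $ i) f) \<gamma> =
      (A ** hessian_coeff f \<gamma>) $ j $ i - (A ** hessian_coeff f \<gamma>) $ i $ j" for i j \<gamma>
    by (simp only: contract_diff_left contract_mult lookup_minus lookup_contract_partials
        lookup_contract_const_mat_partials_shift)
  have "A \<in> Mat_alg f \<longleftrightarrow>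
      (\<forall>i j. i \<noteq> j \<longrightarrow> contract (partials $ i * ?l $ j - partials $ j * ?l $ i) f = 0)"
    unfolding Mat_alg_def I2_subset_ann_iff minors2_two_columns by (auto simp: ann_def)
  also have "\<dots> \<longleftrightarrow> (\<forall>i j. contract (partials $ i * ?l $ j - partials $ j * ?l $ i) f = 0)"
    by (metis contract_zero_left diff_self)
  also have "\<dots> \<longleftrightarrow> (\<forall>i j \<gamma>. (A ** hessian_coeff f \<gamma>) $ j $ i = (A ** hessian_coeff f \<gamma>) $ i $ j)"
    by (simp only: poly_mapping_eq_iff fun_eq_iff minor) simp
  also have "\<dots> \<longleftrightarrow> (\<forall>\<gamma>. transpose (A ** hessian_coeff f \<gamma>) = A ** hessian_coeff f \<gamma>)"
    by (auto simp: vec_eq_iff transpose_def)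
  finally show ?thesis .
qed

section \<open>Commutation on a symmetric tensor\<close>

text \<open>The matrices \<open>H k\<close> are the slices of a totally symmetric tensor with three slots. Moving \<open>A\<close> and
  \<open>B\<close> between the first two slots shows that \<open>A B H\<^sub>k\<close> and \<open>B A H\<^sub>k\<close> are transposes of each other. The
  left factor acts on the first slot, so each of the two tensors \<open>A B T\<close> and \<open>B A T\<close> is also
  symmetric in its last two indices. Thus \<open>A B T\<close> goes over into \<open>B A T\<close> by swapping the first two
  indices and is unchanged by swapping the last two; since
  \<open>(1 2)(2 3)(1 2) = (2 3)(1 2)(2 3)\<close>, where one side involves two passages between the tensors and the
  other only one, the two tensors agree.\<close>

lemma commute_on_symmetric_slices:
  fixes A B :: "'k::field ^ 'n ^ 'n" and H :: "'n \<Rightarrow> 'k ^ 'n ^ 'n"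
  assumes slices: "\<And>i j k. H k $ i $ j = H j $ i $ k"
    and H: "\<And>k. transpose (H k) = H k"
    and A: "\<And>k. transpose (A ** H k) = A ** H k"
    and B: "\<And>k. transpose (B ** H k) = B ** H k"
  shows "A ** B ** H k = B ** A ** H k"
proof -
  have flip: "A ** B ** H k = transpose (B ** A ** H k)" for k
  proof -
    have "A ** B ** H k = A ** transpose (B ** H k)"
      by (simp add: B matrix_mul_assoc)
    also have "\<dots> = A ** H k ** transpose B"
      by (simp add: matrix_transpose_mul H matrix_mul_assoc)
    also have "\<dots> = transpose (A ** H k) ** transpose B"
      by (simp add: A)
    also have "\<dots> = transpose (B ** A ** H k)"
      by (simp add: matrix_transpose_mul matrix_mul_assoc)
    finally show ?thesis .
  qed
  have col: "(C ** H k) $ i $ j = (C ** H j) $ i $ k" for C :: "'k ^ 'n ^ 'n" and i j k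
    by (simp add: matrix_matrix_mult_def slices[of k _ j])
  have flip': "(A ** B ** H k) $ i $ j = (B ** A ** H k) $ j $ i" for i j k
    by (simp add: flip transpose_def)
  \<comment> \<open>The chain of index triples \<open>(i,j,k) \<rightarrow> (i,k,j) \<rightarrow> (k,i,j) \<rightarrow> (k,j,i) \<rightarrow> (j,k,i) \<rightarrow> (j,i,k) \<rightarrow> (i,j,k)\<close>
     alternates \<open>col\<close> and \<open>flip'\<close>; its three uses of \<open>flip'\<close> lead from \<open>A B T\<close> to \<open>B A T\<close>.\<close>
  have "(A ** B ** H k) $ i $ j = (B ** A ** H k) $ i $ j" for i j
    by (metis col flip')
  then show ?thesis by (simp add: vec_eq_iff)
qed

lemma hessian_coeff_slices:
  "hessian_coeff f (\<gamma> + unit_exp k) $ i $ j = hessian_coeff f (\<gamma> + unit_exp j) $ i $ k"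
  by (simp add: hessian_coeff_def ac_simps)

section \<open>Descent from partial derivatives\<close>

lemma exponent_pos_degree_cases:
  fixes \<alpha> :: "'r::finite \<Rightarrow>\<^sub>0 nat"
  assumes "(\<Sum>i\<in>UNIV. Poly_Mapping.lookup \<alpha> i) > 0"
  obtains \<gamma> j where "\<alpha> = \<gamma> + unit_exp j"
proof -
  obtain j where "Poly_Mapping.lookup \<alpha> j > 0"
    using assms by (metis not_gr_zero sum.neutral)
  then have "\<alpha> = (\<alpha> - unit_exp j) + unit_exp j"
    by (intro poly_mapping_eqI) (auto simp: lookup_add lookup_minus lookup_single when_def)
  then show thesis by (rule that)
qed

lemma exponent_degree_add_unit_exp:
  "(\<Sum>i\<in>UNIV. Poly_Mapping.lookup (\<gamma> + unit_exp j) i) =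
    Suc (\<Sum>i\<in>(UNIV::'r::finite set). Poly_Mapping.lookup \<gamma> i)"
  by (simp add: lookup_add sum.distrib lookup_single when_def)

lemma lookup_homogeneous_part:
  assumes "f \<in> homogeneous_part d" "(\<Sum>i\<in>UNIV. Poly_Mapping.lookup \<alpha> i) \<noteq> d"
  shows "Poly_Mapping.lookup f \<alpha> = 0"
  using assms by (auto simp: homogeneous_part_def in_keys_iff)

text \<open>This is the uniqueness of the element \<open>g\<close> in the definition of \<open>\<gamma>\<^sub>f\<close>, in the case that is needed:
  the only possible value at a matrix \<open>A\<close> with \<open>A \<partial> f = 0\<close> is zero.\<close>

lemma partials_inject:
  fixes g :: "('r::finite, 'k::field) divpow"
  assumes "g \<in> homogeneous_part d" "d > 0" "contract_vec partials g = 0"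
  shows "g = 0"
proof (rule poly_mapping_eqI)
  fix \<alpha>
  show "Poly_Mapping.lookup g \<alpha> = Poly_Mapping.lookup 0 \<alpha>"
  proof (cases "(\<Sum>i\<in>UNIV. Poly_Mapping.lookup \<alpha> i) = d")
    case True
    then obtain \<gamma> j where \<alpha>: "\<alpha> = \<gamma> + unit_exp j"
      using exponent_pos_degree_cases assms(2) by metis
    have "contract (partials $ j) g = 0"
      using assms(3) by (simp add: contract_vec_def vec_eq_iff)
    then show ?thesis
      by (metis \<alpha> lookup_contract_partials lookup_zero)
  qed (use assms lookup_homogeneous_part in force)
qed

text \<open>The bound \<open>d \<ge> 3\<close> enters here. At exponents of positive degree the Hessian matrix is a slice of a
  symmetric tensor; at exponent zero it consists of coefficients of \<open>f\<close> in degree 2, which vanish.\<close>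

lemma commutator_annihilates_hessian:
  fixes f :: "('r::finite, 'k::field) divpow"
  assumes f: "f \<in> homogeneous_part d" "d \<ge> 3" and A: "A \<in> Mat_alg f" and B: "B \<in> Mat_alg f"
  shows "A ** B ** hessian_coeff f \<gamma> = B ** A ** hessian_coeff f \<gamma>"
proof (cases "(\<Sum>i\<in>UNIV. Poly_Mapping.lookup \<gamma> i) > 0")
  case True
  then obtain \<delta> k where "\<gamma> = \<delta> + unit_exp k"
    by (rule exponent_pos_degree_cases)
  moreover have "A ** B ** hessian_coeff f (\<delta> + unit_exp k) = B ** A ** hessian_coeff f (\<delta> + unit_exp k)"
    by (rule commute_on_symmetric_slices[where H = "\<lambda>k. hessian_coeff f (\<delta> + unit_exp k)"])
      (use A B in \<open>simp_all only: Mat_alg_iff hessian_coeff_slices[of f \<delta>] transpose_hessian_coeff\<close>)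
  ultimately show ?thesis by simp
next
  case False
  then have "hessian_coeff f \<gamma> = 0"
    using f(2) by (simp add: hessian_coeff_def vec_eq_iff lookup_homogeneous_part[OF f(1)]
        exponent_degree_add_unit_exp del: sum_eq_0_iff)
  then show ?thesis by (simp add: matrix_matrix_mult_def vec_eq_iff)
qed

text \<open>The \<open>j\<close>-th partial of \<open>(C \<partial> f)\<^sub>i\<close> is the entry \<open>(i, j)\<close> of \<open>C H\<close>, and \<open>(C \<partial> f)\<^sub>i\<close> has positive degree
  \<open>d - 1\<close>.\<close>

lemma hessian_kernel_annihilates:
  fixes f :: "('r::finite, 'k::field) divpow"
  assumes f: "f \<in> homogeneous_part d" "d \<ge> 2"
    and C: "\<And>\<gamma>. C ** hessian_coeff f \<gamma> = 0"
  shows "contract ((const_mat C *v partials) $ i) f = 0"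
proof (rule poly_mapping_eqI)
  fix \<alpha>
  show "Poly_Mapping.lookup (contract ((const_mat C *v partials) $ i) f) \<alpha> = Poly_Mapping.lookup 0 \<alpha>"
  proof (cases "(\<Sum>i\<in>UNIV. Poly_Mapping.lookup \<alpha> i) > 0")
    case True
    then obtain \<gamma> j where \<alpha>: "\<alpha> = \<gamma> + unit_exp j"
      by (rule exponent_pos_degree_cases)
    show ?thesis
      unfolding \<alpha> lookup_contract_const_mat_partials_shift by (simp add: C)
  next
    case False
    then show ?thesis
      using f(2) by (simp add: lookup_contract_const_mat_partials lookup_homogeneous_part[OF f(1)]
        exponent_degree_add_unit_exp del: sum_eq_0_iff)
  qed
qed

lemma gamma_eq_0:
  fixes f :: "('r::finite, 'k::field) divpow"
  assumes "d > 0" "contract_vec (const_mat A *v partials) f = 0"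
  shows "gamma d f A = 0"
  unfolding gamma_def
proof (rule the_equality)
  show "0 \<in> homogeneous_part d \<and>
      contract_vec partials 0 = contract_vec (const_mat A *v partials) f"
    by (simp add: assms(2)) (simp add: homogeneous_part_def contract_vec_def vec_eq_iff)
qed (use assms partials_inject in force)

lemma linear_forms_eq_0:
  fixes A :: "'k::field ^ 'r ^ 'r::finite"
  assumes "const_mat A *v partials = 0"
  shows "A = 0"
proof -
  have "unit_exp j = unit_exp k \<longleftrightarrow> j = k" for j k :: 'r
    by (metis lookup_single_eq lookup_single_not_eq nat.distinct(1))
  then have "A $ i $ k = Poly_Mapping.lookup ((const_mat A *v partials) $ i) (unit_exp k)" for i k
    unfolding const_mat_partials
    by (simp add: lookup_sum lookup_single when_def cong: if_cong)
  then show ?thesis by (simp add: assms vec_eq_iff)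
qed

lemma linear_forms_homogeneous:
  fixes A :: "'k::field ^ 'r ^ 'r::finite"
  shows "(const_mat A *v partials) $ i \<in> homogeneous_part 1"
proof -
  have "Poly_Mapping.keys ((const_mat A *v partials) $ i) \<subseteq> range unit_exp"
    unfolding const_mat_partials by (rule order_trans[OF keys_sum]) (auto split: if_splits)
  then show ?thesis
    by (auto simp: homogeneous_part_def lookup_single when_def)
qed

section \<open>The algebra of symmetrizing matrices\<close>

lemma module_matrix_scale: "module (matrix_scale :: 'k::field \<Rightarrow> 'k ^ 'n ^ 'm \<Rightarrow> _)"
  by unfold_locales (simp_all add: matrix_scale_def vec_eq_iff algebra_simps)

lemma transpose_add: "transpose (A + B) = transpose A + transpose B"
  by (simp add: transpose_def vec_eq_iff)

lemma matrix_add_rdistrib: "(A + B) ** C = A ** C + B ** (C :: 'a::comm_ring_1^'n^'m)"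
  by (simp add: matrix_matrix_mult_def vec_eq_iff distrib_right sum.distrib)

lemma matrix_diff_rdistrib: "(A - B) ** C = A ** C - B ** (C :: 'a::comm_ring_1^'n^'m)"
  by (simp add: matrix_matrix_mult_def vec_eq_iff left_diff_distrib sum_subtractf)

lemma subspace_Mat_alg:
  fixes f :: "('r::finite, 'k::field) divpow"
  shows "module.subspace matrix_scale (Mat_alg f)"
proof -
  interpret matrices: module "matrix_scale :: 'k \<Rightarrow> 'k ^ 'r ^ 'r \<Rightarrow> _"
    by (rule module_matrix_scale)
  have "matrix_scale c A ** H = matrix_scale c (A ** H)" for c and A H :: "'k ^ 'r ^ 'r"
    by (simp add: matrix_scale_def matrix_matrix_mult_def vec_eq_iff sum_distrib_left mult.assoc)
  moreover have "transpose (matrix_scale c A) = matrix_scale c (transpose A)" for c and A :: "'k ^ 'r ^ 'r"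
    by (simp add: transpose_def matrix_scale_def vec_eq_iff)
  moreover have "0 ** H = 0" "transpose 0 = 0" for H :: "'k ^ 'r ^ 'r"
    by (simp_all add: matrix_matrix_mult_def transpose_def vec_eq_iff)
  ultimately show ?thesis
    by (auto simp: matrices.subspace_def Mat_alg_iff matrix_add_rdistrib transpose_add)
qed

theorem proposition2p21:
  fixes f :: "('r::finite, 'k::field) divpow" and d :: nat
  assumes "d \<ge> 3" and "f \<in> homogeneous_part d"
  shows "matrix_subalgebra (Mat_alg f)
    \<and> (\<forall>A\<in>Mat_alg f. \<forall>B\<in>Mat_alg f. A ** B - B ** A \<in> ker_gamma d f)
    \<and> (ann_deg f 1 = {0} \<longrightarrow> (\<forall>A\<in>Mat_alg f. \<forall>B\<in>Mat_alg f. A ** B = B ** A))"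
proof (intro conjI impI ballI)
  note comm = commutator_annihilates_hessian[OF assms(2,1)]
  have mult: "A ** B \<in> Mat_alg f" if A: "A \<in> Mat_alg f" and B: "B \<in> Mat_alg f" for A B
    unfolding Mat_alg_iff
  proof
    fix \<gamma>
    let ?H = "hessian_coeff f \<gamma>"
    have "transpose (A ** (B ** ?H)) = transpose (B ** ?H) ** transpose A"
      by (rule matrix_transpose_mul)
    also have "\<dots> = B ** transpose (A ** ?H)"
      using B by (simp add: Mat_alg_iff matrix_transpose_mul matrix_mul_assoc)
    also have "\<dots> = B ** A ** ?H"
      using A by (simp add: Mat_alg_iff matrix_mul_assoc)
    also have "\<dots> = A ** B ** ?H"
      using comm[OF A B] by simp
    finally show "transpose (A ** B ** ?H) = A ** B ** ?H"
      by (simp add: matrix_mul_assoc)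
  qed
  have "mat 1 \<in> Mat_alg f"
    by (simp add: Mat_alg_iff)
  then show "matrix_subalgebra (Mat_alg f)"
    using mult subspace_Mat_alg by (auto simp: matrix_subalgebra_def)
  have ann: "contract ((const_mat (A ** B - B ** A) *v partials) $ i) f = 0"
    if A: "A \<in> Mat_alg f" and B: "B \<in> Mat_alg f" for A B i
    by (rule hessian_kernel_annihilates[OF assms(2)])
      (use assms(1) comm[OF A B] in \<open>simp_all add: matrix_diff_rdistrib\<close>)
  {
    fix A B assume A: "A \<in> Mat_alg f" and B: "B \<in> Mat_alg f"
    interpret matrices: module "matrix_scale :: 'k \<Rightarrow> 'k ^ 'r ^ 'r \<Rightarrow> _"
      by (rule module_matrix_scale)
    have "A ** B - B ** A \<in> Mat_alg f"
      using A B mult subspace_Mat_alg by (intro matrices.subspace_diff)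
    moreover have "gamma d f (A ** B - B ** A) = 0"
      using assms(1) ann[OF A B] by (intro gamma_eq_0) (simp_all add: contract_vec_def vec_eq_iff)
    ultimately show "A ** B - B ** A \<in> ker_gamma d f"
      by (simp add: ker_gamma_def)
    assume "ann_deg f 1 = {0}"
    then have "(const_mat (A ** B - B ** A) *v partials) $ i = 0" for i
      using ann[OF A B] linear_forms_homogeneous[of "A ** B - B ** A" i]
      by (auto simp: ann_deg_def ann_def)
    then have "A ** B - B ** A = 0"
      by (intro linear_forms_eq_0) (simp add: vec_eq_iff)
    then show "A ** B = B ** A" by simp
  }
qed

end
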